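(* Let $n\ge 1$ and let $\Phi=\{f_1,\ldots,f_k\}$ be a finite subset of the free MV-algebra $\mathbf{F}_n$, with $k$ elements. Let $\mathscr{D}_\Phi$ be the set of all coherent books on $\Phi$ and $\mathscr{K}_\Phi$ the set of all strictly coherent books on $\Phi$, both regarded as subsets of $\mathbb{R}^k$. Then $$\mathscr{K}_\Phi=\mathrm{relint}\,\mathscr{D}_\Phi,$$ where $\mathrm{relint}$ denotes the relative interior of a convex set.
   Context: $\mathbf{F}_n$ is the free $n$-generated MV-algebra, identified with the algebra of all $n$-variable McNaughton functions: continuous functions $f:[0,1]^n\to[0,1]$ that are piecewise linear (affine) with finitely many pieces, each piece having integer coefficients. The operations are pointwise, with $x\oplus y=\min\{1,x+y\}$, $\neg x=1-x$, $x\odot y=\max\{0,x+y-1\}$ on $[0,1]$. Homomorphisms of $\mathbf{F}_n$ into the standard MV-algebra $[0,1]$ (valuations of Łukasiewicz logic) are exactly the evaluations $f\mapsto f(x)$ at points $x\in[0,1]^n$. A book on $\Phi=\{f_1,\ldots,f_k\}$ is a map $\beta:\Phi\to[0,1]$; it is identified with the point $\langle\beta(f_1),\ldots,\beta(f_k)\rangle\in\mathbb{R}^k$. The book $\beta$ is coherent if there are no $\sigma_1,\ldots,\sigma_k\in\mathbb{R}$ such that $\sum_{i=1}^k\sigma_i(\beta(f_i)-f_i(x))<0$ for every $x\in[0,1]^n$. The book $\beta$ is strictly coherent if for all $\sigma_1,\ldots,\sigma_k\in\mathbb{R}$, the existence of $x\in[0,1]^n$ with $\sum_{i=1}^k\sigma_i(\beta(f_i)-f_i(x))<0$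 implies the existence of $x'\in[0,1]^n$ with $\sum_{i=1}^k\sigma_i(\beta(f_i)-f_i(x'))>0$. *)

theory Defs
  imports "HOL-Analysis.Analysis"
begin

definition unit_cube :: "(real ^ 'n) set" where
  "unit_cube = {x. \<forall>i. 0 \<le> x $ i \<and> x $ i \<le> 1}"

text \<open>
  The free MV-algebra on \<^typ>\<open>'n\<close>-many generators, identified with the algebra of McNaughton
  functions. A pair \<open>(a, b)\<close> encodes the affine piece \<open>x \<mapsto> a \<bullet> x + b\<close> with integer coefficients.
  The functions are made extensional so that HOL equality of elements is equality of functions
  on the cube.
\<close>
definition free_MV :: "(real ^ 'n \<Rightarrow> real) set" where
  "free_MV = {f \<in> unit_cube \<rightarrow>\<^sub>E {0..1}. continuous_on unit_cube f \<and>
     (\<exists>P :: ((int ^ 'n) \<times> int) set. finite P \<and>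
        (\<forall>x\<in>unit_cube. \<exists>(a, b)\<in>P. f x = (\<Sum>i\<in>UNIV. of_int (a $ i) * x $ i) + of_int b))}"

definition books :: "(real ^ 'n \<Rightarrow> real) set \<Rightarrow> ((real ^ 'n \<Rightarrow> real) \<Rightarrow> real) set" where
  "books \<Phi> = \<Phi> \<rightarrow>\<^sub>E {0..1}"

definition coherent :: "(real ^ 'n \<Rightarrow> real) set \<Rightarrow> ((real ^ 'n \<Rightarrow> real) \<Rightarrow> real) \<Rightarrow> bool" where
  "coherent \<Phi> \<beta> \<longleftrightarrow>
     \<not> (\<exists>\<sigma> :: (real ^ 'n \<Rightarrow> real) \<Rightarrow> real.
          \<forall>x\<in>unit_cube. (\<Sum>f\<in>\<Phi>. \<sigma> f * (\<beta> f - f x)) < 0)"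

definition strictly_coherent ::
    "(real ^ 'n \<Rightarrow> real) set \<Rightarrow> ((real ^ 'n \<Rightarrow> real) \<Rightarrow> real) \<Rightarrow> bool" where
  "strictly_coherent \<Phi> \<beta> \<longleftrightarrow>
     (\<forall>\<sigma> :: (real ^ 'n \<Rightarrow> real) \<Rightarrow> real.
        (\<exists>x\<in>unit_cube. (\<Sum>f\<in>\<Phi>. \<sigma> f * (\<beta> f - f x)) < 0) \<longrightarrow>
        (\<exists>x'\<in>unit_cube. (\<Sum>f\<in>\<Phi>. \<sigma> f * (\<beta> f - f x')) > 0))"

text \<open>
  The identification of a book on \<open>\<Phi> = {e 1, \<dots>, e k}\<close> with a point of \<open>\<real>\<^sup>k\<close> depends on the
  enumeration \<open>e\<close> of \<open>\<Phi>\<close>.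
\<close>
definition book_point ::
    "('k \<Rightarrow> real ^ 'n \<Rightarrow> real) \<Rightarrow> ((real ^ 'n \<Rightarrow> real) \<Rightarrow> real) \<Rightarrow> real ^ 'k" where
  "book_point e \<beta> = (\<chi> i. \<beta> (e i))"

definition coherent_books ::
    "('k \<Rightarrow> real ^ 'n \<Rightarrow> real) \<Rightarrow> (real ^ 'n \<Rightarrow> real) set \<Rightarrow> (real ^ 'k) set" where
  "coherent_books e \<Phi> = book_point e ` {\<beta> \<in> books \<Phi>. coherent \<Phi> \<beta>}"

definition strictly_coherent_books ::
    "('k \<Rightarrow> real ^ 'n \<Rightarrow> real) \<Rightarrow> (real ^ 'n \<Rightarrow> real) set \<Rightarrow> (real ^ 'k) set" where
  "strictly_coherent_books e \<Phi> = book_point e ` {\<beta> \<in> books \<Phi>. strictly_coherent \<Phi> \<beta>}"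

end

theory Submission
  imports Defs
begin

text \<open>
  Let \<open>S \<subseteq> \<real>\<^sup>k\<close> be the image of the cube under \<open>x \<mapsto> (e 1 x, \<dots>, e k x)\<close>; it is compact, so its
  convex hull \<open>C\<close> is closed. A book is incoherent iff some hyperplane strictly separates it from
  \<open>S\<close>, hence the coherent books are exactly the points of \<open>C\<close>. Strict coherence says that no
  hyperplane through the book supports \<open>S\<close> without containing it. A point of \<open>C\<close> outside the
  relative interior has such a supporting hyperplane; a point of the relative interior has none,
  since segments in \<open>C\<close> can be prolonged slightly beyond it.
\<close>

text \<open>An open half-space containing \<open>S\<close> contains its hull by convexity.
  Conversely, compactness of \<open>S\<close> makes the hull closed, so a point outside it can be
  strictly separated.\<close>

lemma in_convex_hull_iff_no_strict_separation:
  fixes S :: "'a::euclidean_space set"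
  assumes "compact S"
  shows "b \<in> convex hull S \<longleftrightarrow> \<not> (\<exists>v. \<forall>s\<in>S. v \<bullet> (b - s) < 0)"
proof
  assume b: "b \<in> convex hull S"
  show "\<not> (\<exists>v. \<forall>s\<in>S. v \<bullet> (b - s) < 0)"
  proof
    assume "\<exists>v. \<forall>s\<in>S. v \<bullet> (b - s) < 0"
    then obtain v where "S \<subseteq> {s. v \<bullet> s > v \<bullet> b}"
      by (auto simp: inner_diff_right)
    then have "convex hull S \<subseteq> {s. v \<bullet> s > v \<bullet> b}"
      by (rule hull_minimal) (rule convex_halfspace_gt)
    with b show False by auto
  qed
next
  assume no_sep: "\<not> (\<exists>v. \<forall>s\<in>S. v \<bullet> (b - s) < 0)"
  show "b \<in> convex hull S"
  proof (rule ccontr)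
    assume "b \<notin> convex hull S"
    moreover have "closed (convex hull S)"
      using assms by (simp add: compact_convex_hull compact_imp_closed)
    ultimately obtain v c where "v \<bullet> b < c" "\<forall>s\<in>convex hull S. v \<bullet> s > c"
      using separating_hyperplane_closed_point[OF convex_convex_hull] by metis
    then have "\<forall>s\<in>S. v \<bullet> (b - s) < 0"
      by (fastforce simp: inner_diff_right dest: hull_inc)
    with no_sep show False by blast
  qed
qed

lemma in_rel_interior_convex_hull_iff_no_proper_support:
  fixes S :: "'a::euclidean_space set"
  assumes "compact S" "S \<noteq> {}"
  shows "b \<in> rel_interior (convex hull S) \<longleftrightarrow>
    (\<forall>v. (\<exists>s\<in>S. v \<bullet> (b - s) < 0) \<longrightarrow> (\<exists>s\<in>S. v \<bullet> (b - s) > 0))"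
proof
  assume b: "b \<in> rel_interior (convex hull S)"
  show "\<forall>v. (\<exists>s\<in>S. v \<bullet> (b - s) < 0) \<longrightarrow> (\<exists>s\<in>S. v \<bullet> (b - s) > 0)"
  proof (intro allI impI, rule ccontr)
    fix v
    assume "\<exists>s\<in>S. v \<bullet> (b - s) < 0" and "\<not> (\<exists>s\<in>S. v \<bullet> (b - s) > 0)"
    then obtain s where s: "s \<in> S" "v \<bullet> b < v \<bullet> s" and "S \<subseteq> {s. v \<bullet> s \<ge> v \<bullet> b}"
      by (auto simp: inner_diff_right not_less)
    then have sub: "convex hull S \<subseteq> {s. v \<bullet> s \<ge> v \<bullet> b}"
      by (metis hull_minimal convex_halfspace_ge)
    \<comment> \<open>The segment from \<open>s\<close> to \<open>b\<close> is prolonged past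
      \<open>b\<close> inside the hull, to a point on the wrong side of the hyperplane. Prolongation
      starts from any point of the affine hull of the convex hull, hence the nested
      \<open>hull_inc\<close>.\<close>
    obtain t where t: "t > 1" "(1 - t) *\<^sub>R s + t *\<^sub>R b \<in> convex hull S"
      using convex_rel_interior_if2[OF convex_convex_hull b] hull_inc[OF hull_inc[OF s(1)]]
      by blast
    then have "v \<bullet> ((1 - t) *\<^sub>R s + t *\<^sub>R b) \<ge> v \<bullet> b"
      using sub by auto
    then have "(t - 1) * (v \<bullet> b - v \<bullet> s) \<ge> 0"
      by (simp add: inner_add_right left_diff_distrib right_diff_distrib)
    moreover have "(t - 1) * (v \<bullet> b - v \<bullet> s) < 0"
      using t(1) s(2) by (simp add: mult_pos_neg)
    ultimately show False by linarith
  qed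
next
  assume strict: "\<forall>v. (\<exists>s\<in>S. v \<bullet> (b - s) < 0) \<longrightarrow> (\<exists>s\<in>S. v \<bullet> (b - s) > 0)"
  show "b \<in> rel_interior (convex hull S)"
  proof (rule ccontr)
    assume b: "b \<notin> rel_interior (convex hull S)"
    \<comment> \<open>A strict separation would make \<open>v \<bullet> (b - s)\<close> negative on
      all of the nonempty \<open>S\<close>, so \<open>strict\<close> would also yield a positive
      value.\<close>
    have "b \<in> convex hull S"
      unfolding in_convex_hull_iff_no_strict_separation[OF assms(1)]
      using strict assms(2) by (meson all_not_in_conv less_asym)
    from supporting_hyperplane_rel_boundary[OF convex_convex_hull this b] obtain v
      where le: "\<And>y. y \<in> convex hull S \<Longrightarrow> v \<bullet> b \<le> v \<bullet> y"
        and less: "\<And>y. y \<in> rel_interior (convex hull S) \<Longrightarrow> v \<bullet> b < v \<bullet> y"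
      by blast
    \<comment> \<open>The point \<open>y\<close> lies strictly off the supporting hyperplane, which
      prevents \<open>S\<close> from lying in it.\<close>
    obtain y where y: "y \<in> rel_interior (convex hull S)"
      using assms(2) rel_interior_eq_empty[OF convex_convex_hull, of S] by auto
    have "\<exists>s\<in>S. v \<bullet> (b - s) < 0"
    proof (rule ccontr)
      assume "\<not> ?thesis"
      then have "S \<subseteq> {s. v \<bullet> s \<le> v \<bullet> b}"
        by (auto simp: inner_diff_right not_less)
      then have "convex hull S \<subseteq> {s. v \<bullet> s \<le> v \<bullet> b}"
        by (rule hull_minimal) (rule convex_halfspace_le)
      then have "v \<bullet> y \<le> v \<bullet> b"
        using y rel_interior_subset by blast
      with less[OF y] show False by linarith
    qed
    with strict obtain s where "s \<in> S" "v \<bullet> (b - s) > 0" by blast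
    with le[of s] show False by (simp add: hull_inc inner_diff_right)
  qed
qed

lemma unit_cube_eq_cbox: "unit_cube = cbox 0 (1 :: real ^ 'n::finite)"
  by (auto simp: unit_cube_def mem_box_cart)

text \<open>The valuation at \<open>x\<close> as a point of the space of books; the image of the
  cube is the set \<open>S\<close> of the overview.\<close>

definition value_point :: "('k \<Rightarrow> 'a \<Rightarrow> real) \<Rightarrow> 'a \<Rightarrow> real ^ 'k" where
  "value_point e x = (\<chi> i. e i x)"

lemma sum_eq_inner_book_point:
  assumes "bij_betw e UNIV \<Phi>"
  shows "(\<Sum>f\<in>\<Phi>. \<sigma> f * (\<beta> f - f x)) = (\<chi> i. \<sigma> (e i)) \<bullet> (book_point e \<beta> - value_point e x)"
  by (subst sum.reindex_bij_betw[OF assms, symmetric])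
     (simp add: inner_vec_def book_point_def value_point_def)

text \<open>Lets stakes be traded for normal vectors: as \<open>e\<close> is injective,
  \<open>inv e\<close> turns every vector into a stake function inducing it.\<close>

lemma ex_stakes_iff:
  fixes e :: "'k::finite \<Rightarrow> 'b"
  assumes "bij_betw e UNIV \<Phi>"
  shows "(\<exists>\<sigma>::'b \<Rightarrow> real. P (\<chi> i. \<sigma> (e i))) \<longleftrightarrow> (\<exists>v. P v)"
proof
  assume "\<exists>v. P v"
  then obtain v where "P v" ..
  moreover have "(\<chi> i. v $ inv e (e i)) = v"
    using assms by (simp add: bij_betw_def vec_eq_iff)
  ultimately show "\<exists>\<sigma>::'b \<Rightarrow> real. P (\<chi> i. \<sigma> (e i))"
    by (intro exI[of _ "\<lambda>f. v $ inv e f"]) simp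
qed blast

context
  fixes \<Phi> :: "(real ^ 'n::finite \<Rightarrow> real) set"
    and e :: "'k::finite \<Rightarrow> real ^ 'n \<Rightarrow> real"
  assumes sub: "\<Phi> \<subseteq> free_MV"
    and bij: "bij_betw e UNIV \<Phi>"
begin

lemma enum_in_free_MV: "e i \<in> free_MV"
  using sub bij by (auto simp: bij_betw_def)

lemma compact_value_points: "compact (value_point e ` unit_cube)"
proof (rule compact_continuous_image)
  show "continuous_on unit_cube (value_point e)"
    unfolding value_point_def using enum_in_free_MV
    by (intro continuous_on_vec_lambda) (auto simp: free_MV_def)
qed (simp add: unit_cube_eq_cbox)

lemma value_points_nonempty: "value_point e ` unit_cube \<noteq> {}"
  by (auto simp: unit_cube_def intro!: exI[of _ 0])

lemma coherent_iff:
  "coherent \<Phi> \<beta> \<longleftrightarrow> book_point e \<beta> \<in> convex hull (value_point e ` unit_cube)"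
  unfolding coherent_def sum_eq_inner_book_point[OF bij]
    in_convex_hull_iff_no_strict_separation[OF compact_value_points]
  using ex_stakes_iff[OF bij, of "\<lambda>v. \<forall>x\<in>unit_cube. v \<bullet> (book_point e \<beta> - value_point e x) < 0"]
  by simp

lemma strictly_coherent_iff:
  "strictly_coherent \<Phi> \<beta> \<longleftrightarrow>
     book_point e \<beta> \<in> rel_interior (convex hull (value_point e ` unit_cube))"
  unfolding strictly_coherent_def sum_eq_inner_book_point[OF bij]
    in_rel_interior_convex_hull_iff_no_proper_support[OF compact_value_points value_points_nonempty]
  \<comment> \<open>Strict coherence is universal in the stakes, so the existential transfer is
    applied to its counterexamples.\<close>
  using ex_stakes_iff[OF bij, of "\<lambda>v. (\<exists>x\<in>unit_cube. v \<bullet> (book_point e \<beta> - value_point e x) < 0)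
    \<and> \<not> (\<exists>x\<in>unit_cube. v \<bullet> (book_point e \<beta> - value_point e x) > 0)"]
  by (simp; blast)

text \<open>The unit box is convex and contains all value points, hence their hull. This makes every
  point of the hull an actual book, so that the characterisations above give equalities of
  sets.\<close>

lemma convex_hull_value_points_subset_books:
  "convex hull (value_point e ` unit_cube) \<subseteq> book_point e ` books \<Phi>"
proof
  fix b assume "b \<in> convex hull (value_point e ` unit_cube)"
  moreover have "convex hull (value_point e ` unit_cube) \<subseteq> cbox 0 1"
    using enum_in_free_MV
    by (intro hull_minimal convex_box) (fastforce simp: value_point_def mem_box_cart free_MV_def)
  ultimately have "b \<in> cbox 0 1" by blast
  \<comment> \<open>Books are extensional on \<open>\<Phi>\<close>, hence
    \<open>restrict\<close>.\<close>
  then have "restrict (\<lambda>f. b $ inv e f) \<Phi> \<in> books \<Phi>"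
    by (auto simp: books_def mem_box_cart)
  moreover have "book_point e (restrict (\<lambda>f. b $ inv e f) \<Phi>) = b"
    using bij by (auto simp: book_point_def vec_eq_iff bij_betw_def)
  ultimately show "b \<in> book_point e ` books \<Phi>" by force
qed

lemma coherent_books_eq: "coherent_books e \<Phi> = convex hull (value_point e ` unit_cube)"
  using convex_hull_value_points_subset_books
  by (auto simp: coherent_books_def coherent_iff)

lemma strictly_coherent_books_eq:
  "strictly_coherent_books e \<Phi> = rel_interior (convex hull (value_point e ` unit_cube))"
  using convex_hull_value_points_subset_books
    rel_interior_subset[of "convex hull (value_point e ` unit_cube)"]
  by (auto simp: strictly_coherent_books_def strictly_coherent_iff)

end

theorem theorem3p4:
  fixes \<Phi> :: "(real ^ 'n::finite \<Rightarrow> real) set"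
    and e :: "'k::finite \<Rightarrow> real ^ 'n \<Rightarrow> real"
  assumes "\<Phi> \<subseteq> free_MV"
    and "bij_betw e UNIV \<Phi>"
  shows "strictly_coherent_books e \<Phi> = rel_interior (coherent_books e \<Phi>)"
  by (simp add: coherent_books_eq[OF assms] strictly_coherent_books_eq[OF assms])

end
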